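(* Let $X$ be an indeterminate and let $n,r,s$ be three positive integers. Then $$\sum_{|\mu|=n}\frac{X^{l(\mu)-1}}{z_\mu}\left(\sum_{i=1}^{l(\mu)}(\mu_i)_r\,(\mu_i)_s\right)=\frac{r!\,s!}{r+s}\sum_{k=1}^{\min(n,r+s)}\binom{r+s}{s}_k\binom{X+n-1}{n-k},$$ where the sum on the left is over all partitions $\mu$ of $n$.
   Context: A partition $\mu=(\mu_1,\dots,\mu_l)$ is a finite weakly decreasing sequence of positive integers (its parts); $l(\mu)=l$ is its length and $|\mu|=\sum_i\mu_i$ its weight. For $i\ge1$, $m_i(\mu)$ is the number of $j$ with $\mu_j=i$, and $z_\mu=\prod_{i\ge1}i^{m_i(\mu)}\,m_i(\mu)!$. For $a$ a number and $j\ge 0$ an integer, $(a)_j=a(a+1)\cdots(a+j-1)$ denotes the raising factorial, with $(a)_0=1$. For a polynomial $Y$ in $X$ and an integer $j\ge0$, $\binom{Y}{j}=Y(Y-1)\cdots(Y-j+1)/j!$. For integers $N\ge 1$, $0\le p\le N$, $k\ge 0$, define $$\binom{N}{p}_k=\binom{N}{k}\;{}_3F_2\!\left[\begin{matrix}1-k,\,-p,\,p-N\\ 1-N,\,1\end{matrix};1\right]=\binom{N}{k}\sum_{j=0}^{\min(p,N-p)}\frac{(1-k)_j\,(-p)_j\,(p-N)_j}{(1-N)_j\,(1)_j\,j!}.$$ The sum is finite because $(-p)_j(p-N)_j=0$ for $j>\min(p,N-p)$, and the denominators are nonzero in the stated range. Here $\binom{N}{k}$ is the usual binomial coefficient, equal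 to $0$ for $k>N$. *)

theory Defs
  imports "HOL-Computational_Algebra.Polynomial"
begin

definition partitions :: "nat \<Rightarrow> nat list set" where
  "partitions n = {mu. sorted_wrt (\<ge>) mu \<and> (\<forall>x\<in>set mu. 0 < x) \<and> sum_list mu = n}"

lemma finite_partitions: "finite (partitions n)"
proof (rule finite_subset)
  have "length mu \<le> sum_list mu" if "\<forall>x\<in>set mu. 0 < x" for mu :: "nat list"
    using that by (induction mu) auto
  then show "partitions n \<subseteq> {mu. set mu \<subseteq> {..n} \<and> length mu \<le> n}"
    using member_le_sum_list by (fastforce simp: partitions_def)
  show "finite {mu. set mu \<subseteq> {..n} \<and> length mu \<le> n}"
    by (rule finite_lists_length_le) simp
qed

text \<open>The multiplicity \<open>m\<^sub>i\<close> is \<open>count_list mu i\<close>. Values \<open>i\<close> that are not parts of \<open>mu\<close> have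
  \<open>m\<^sub>i = 0\<close> and would contribute a factor 1, so the product is restricted to the parts.\<close>

definition z_part :: "nat list \<Rightarrow> nat" where
  "z_part mu = (\<Prod>i\<in>set mu. i ^ count_list mu i * fact (count_list mu i))"

text \<open>The sum is the terminating series
  \<open>3F2(1 - k, -p, p - N; 1 - N, 1; 1)\<close>, meant for \<open>N \<ge> 1\<close> and \<open>p \<le> N\<close>. The two equal-looking
  factors in the denominator are the lower parameter \<open>(1)\<^sub>j\<close> and the \<open>j!\<close> of the series.
  All differences of parameters are taken in the rationals.\<close>

definition gen_binom :: "nat \<Rightarrow> nat \<Rightarrow> nat \<Rightarrow> rat" where
  "gen_binom N p k = of_nat (N choose k) *
     (\<Sum>j=0..min p (N - p).
        (pochhammer (1 - of_nat k) j * pochhammer (- of_nat p) j * pochhammer (of_nat p - of_nat N) j)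
        / (pochhammer (1 - of_nat N) j * pochhammer 1 j * fact j))"

abbreviation X :: "rat poly" where
  "X \<equiv> [:0, 1:]"

text \<open>The library constant \<open>gchoose\<close> is constrained to fields of characteristic 0 and does not
  apply to polynomials.\<close>

definition poly_binom :: "rat poly \<Rightarrow> nat \<Rightarrow> rat poly" where
  "poly_binom Y j = smult (1 / fact j) (\<Prod>i<j. Y - of_nat i)"

end

theory Submission
  imports Defs "HOL-Library.Multiset" "HOL-Computational_Algebra.Formal_Power_Series"
begin

text \<open>Let \<open>A m\<close> be the sum of \<open>x ^ l(\<mu>) / z\<^sub>\<mu>\<close> over the partitions of \<open>m\<close>. Removing a marked part \<open>i\<close>
  from a partition of \<open>n\<close> shows that an additive weight \<open>f\<close> of the parts contributes the sum of
  \<open>f i / i * A (n - i)\<close>. The weight \<open>f i = i\<close> gives a recurrence whose solution is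
  \<open>A m = pochhammer x m / m!\<close>, the coefficient of \<open>q ^ m\<close> in \<open>(1 - q) powr (-x)\<close>. For the weight of
  the theorem, \<open>f i / i\<close> is a combination of the coefficients \<open>(i - 1) choose (k - 1)\<close> of
  \<open>(q / (1 - q)) ^ k\<close>, by Vandermonde's convolution and Riordan's expansion of a product of two
  binomials in \<open>x\<close>, taken at \<open>x = -i\<close>.\<close>

section \<open>Partitions as multisets\<close>

definition mset_partitions :: "nat \<Rightarrow> nat multiset set" where
  "mset_partitions n = {M. 0 \<notin># M \<and> sum_mset M = n}"

definition z_mset :: "nat multiset \<Rightarrow> nat" where
  "z_mset M = (\<Prod>i\<in>set_mset M. i ^ count M i * fact (count M i))"

lemma z_mset_mset: "z_mset (mset mu) = z_part mu"
  by (simp add: z_mset_def z_part_def count_mset)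

text \<open>Sorting increasingly and reversing recovers the decreasing list from its multiset. In
  multisets a part can be added or removed without any reordering.\<close>

lemma bij_betw_mset_partitions: "bij_betw mset (partitions n) (mset_partitions n)"
proof (rule bij_betw_byWitness[where f' = "\<lambda>M. rev (sorted_list_of_multiset M)"])
  show "\<forall>mu\<in>partitions n. rev (sorted_list_of_multiset (mset mu)) = mu"
  proof
    fix mu assume "mu \<in> partitions n"
    then have "sorted (rev mu)"
      by (simp add: partitions_def sorted_wrt_rev)
    then have "sorted_list_of_multiset (mset mu) = rev mu"
      by (metis mset_rev sorted_list_of_multiset_mset sorted_sort_id)
    then show "rev (sorted_list_of_multiset (mset mu)) = mu"
      by simp
  qed
  show "\<forall>M\<in>mset_partitions n. mset (rev (sorted_list_of_multiset M)) = M"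
    by simp
  show "mset ` partitions n \<subseteq> mset_partitions n"
    by (auto simp: partitions_def mset_partitions_def sum_mset_sum_list)
  show "(\<lambda>M. rev (sorted_list_of_multiset M)) ` mset_partitions n \<subseteq> partitions n"
  proof safe
    fix M assume M: "M \<in> mset_partitions n"
    have "sum_list (sorted_list_of_multiset M) = n"
      using M by (metis (mono_tags, lifting) mem_Collect_eq mset_partitions_def
        mset_sorted_list_of_multiset sum_mset_sum_list)
    moreover have "\<forall>x\<in>set_mset M. 0 < x"
      using M by (metis (mono_tags, lifting) gr0I mem_Collect_eq mset_partitions_def)
    ultimately show "rev (sorted_list_of_multiset M) \<in> partitions n"
      by (auto simp: partitions_def sorted_wrt_rev)
  qed
qed

lemma finite_mset_partitions: "finite (mset_partitions n)"
  using bij_betw_finite[OF bij_betw_mset_partitions] finite_partitions by blast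

text \<open>Indices of multiplicity 0 contribute the factor 1, so two multisets can be compared over
  a common index set.\<close>

lemma z_mset_superset:
  assumes "finite A" "set_mset M \<subseteq> A"
  shows "z_mset M = (\<Prod>i\<in>A. i ^ count M i * fact (count M i))"
  unfolding z_mset_def
  by (rule prod.mono_neutral_left) (use assms in \<open>auto simp: not_in_iff\<close>)

text \<open>Only the factor at \<open>i\<close> changes: the power gains \<open>i\<close> and the
  factorial gains \<open>Suc (count M i)\<close>.\<close>

lemma z_mset_add_mset: "z_mset (add_mset i M) = i * Suc (count M i) * z_mset M"
proof -
  let ?A = "insert i (set_mset M)"
  have "z_mset (add_mset i M) = (\<Prod>j\<in>?A. j ^ count (add_mset i M) j * fact (count (add_mset i M) j))"
    by (simp add: z_mset_def)
  also have "\<dots> = (i ^ Suc (count M i) * fact (Suc (count M i))) *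
      (\<Prod>j\<in>?A - {i}. j ^ count M j * fact (count M j))"
    by (subst prod.remove[where x = i]) (auto intro!: prod.cong)
  also have "\<dots> = i * Suc (count M i) * ((i ^ count M i * fact (count M i)) *
      (\<Prod>j\<in>?A - {i}. j ^ count M j * fact (count M j)))"
    by (simp only: power_Suc fact_Suc of_nat_id ac_simps)
  also have "(i ^ count M i * fact (count M i)) *
      (\<Prod>j\<in>?A - {i}. j ^ count M j * fact (count M j)) = z_mset M"
    by (subst z_mset_superset[of ?A]) (auto simp: prod.remove[where x = i and A = ?A])
  finally show ?thesis .
qed

text \<open>Groups equal parts. The index range does not depend on \<open>M\<close>, so that this
  sum can later be exchanged with the sum over partitions.\<close>

lemma sum_image_mset_partition:
  fixes f :: "nat \<Rightarrow> 'a::comm_semiring_1"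
  assumes "M \<in> mset_partitions n"
  shows "sum_mset (image_mset f M) = (\<Sum>i=1..n. of_nat (count M i) * f i)"
proof -
  have sub: "set_mset M \<subseteq> {1..n}"
  proof
    fix i assume i: "i \<in># M"
    then have "i \<le> n"
      using assms sum_mset.remove[OF i] by (simp add: mset_partitions_def)
    moreover have "i \<noteq> 0"
      using assms i by (metis (mono_tags, lifting) mem_Collect_eq mset_partitions_def)
    ultimately show "i \<in> {1..n}" by simp
  qed
  \<comment> \<open>The induction uses a fixed superset \<open>A\<close>, because dropping an
    element does not leave a partition of the same \<open>n\<close>.\<close>
  have "set_mset M \<subseteq> A \<Longrightarrow> finite A \<Longrightarrow>
      sum_mset (image_mset f M) = (\<Sum>i\<in>A. of_nat (count M i) * f i)" for A
  proof (induction M)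
    case (add x M)
    have "(\<Sum>i\<in>A. of_nat (count (add_mset x M) i) * f i) =
        (\<Sum>i\<in>A. of_nat (count M i) * f i + (if i = x then f x else 0))"
      by (rule sum.cong) (auto simp: algebra_simps)
    also have "\<dots> = f x + (\<Sum>i\<in>A. of_nat (count M i) * f i)"
      using add.prems by (simp add: sum.distrib add.commute)
    finally show ?case using add by simp
  qed simp
  from this[OF sub] show ?thesis by simp
qed

section \<open>Sums over partitions with additive weights\<close>

text \<open>This is \<open>A n\<close> of the overview: the complete homogeneous symmetric function
  of degree \<open>n\<close>, expanded in power sums that are all set to \<open>x\<close>.\<close>

definition part_sum :: "'a::field_char_0 \<Rightarrow> nat \<Rightarrow> 'a" where
  "part_sum x n = (\<Sum>M\<in>mset_partitions n. x ^ size M / of_nat (z_mset M))"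

text \<open>Removing one part \<open>i\<close> from a partition divides \<open>z\<close> by \<open>i\<close> times the multiplicity of \<open>i\<close>.\<close>

lemma sum_count_partitions:
  fixes x :: "'a::field_char_0"
  assumes "0 < i" "i \<le> n"
  shows "(\<Sum>M\<in>mset_partitions n. of_nat (count M i) * x ^ (size M - 1) / of_nat (z_mset M))
    = part_sum x (n - i) / of_nat i"
proof -
  have "(\<Sum>M\<in>mset_partitions n. of_nat (count M i) * x ^ (size M - 1) / of_nat (z_mset M))
    = (\<Sum>M\<in>{M \<in> mset_partitions n. i \<in># M}.
        of_nat (count M i) * x ^ (size M - 1) / of_nat (z_mset M))"
    by (rule sum.mono_neutral_right) (auto simp: finite_mset_partitions not_in_iff)
  also have "\<dots> = (\<Sum>M\<in>mset_partitions (n - i). x ^ size M / of_nat (z_mset M) / of_nat i)"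
  proof (rule sum.reindex_bij_witness[where i = "add_mset i" and j = "\<lambda>M. M - {#i#}"])
    fix M assume M: "M \<in> {M \<in> mset_partitions n. i \<in># M}"
    then obtain M' where M': "M = add_mset i M'"
      by (auto dest: multi_member_split)
    show "M - {#i#} \<in> mset_partitions (n - i)"
      using M by (auto simp: M' mset_partitions_def)
    have "of_nat (count M i) = (of_nat (Suc (count M' i)) :: 'a)"
      by (simp add: M')
    moreover have "of_nat (z_mset M) = (of_nat i * of_nat (Suc (count M' i)) * of_nat (z_mset M') :: 'a)"
      by (simp only: M' z_mset_add_mset of_nat_mult)
    moreover have "(of_nat (Suc (count M' i)) :: 'a) \<noteq> 0"
      by (simp only: of_nat_eq_0_iff)
    ultimately show "x ^ size (M - {#i#}) / of_nat (z_mset (M - {#i#})) / of_nat i =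
        of_nat (count M i) * x ^ (size M - 1) / of_nat (z_mset M)"
      by (simp add: M' del: of_nat_Suc)
  next
    fix M assume "M \<in> mset_partitions (n - i)"
    then show "add_mset i M \<in> {M \<in> mset_partitions n. i \<in># M}"
      using assms by (auto simp: mset_partitions_def)
  qed auto
  also have "\<dots> = part_sum x (n - i) / of_nat i"
    by (simp add: part_sum_def sum_divide_distrib)
  finally show ?thesis .
qed

text \<open>After grouping equal parts and exchanging the sums, \<open>sum_count_partitions\<close>
  evaluates the contribution of each part size \<open>i\<close>.\<close>

lemma sum_partitions_parts:
  fixes x :: "'a::field_char_0"
  shows "(\<Sum>M\<in>mset_partitions n. sum_mset (image_mset f M) * x ^ (size M - 1) / of_nat (z_mset M))
    = (\<Sum>i=1..n. f i / of_nat i * part_sum x (n - i))"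
proof -
  have "(\<Sum>M\<in>mset_partitions n. sum_mset (image_mset f M) * x ^ (size M - 1) / of_nat (z_mset M))
    = (\<Sum>M\<in>mset_partitions n. \<Sum>i=1..n.
        f i * (of_nat (count M i) * x ^ (size M - 1) / of_nat (z_mset M)))"
    by (intro sum.cong refl, simp only: sum_image_mset_partition sum_distrib_right sum_divide_distrib)
      (simp add: mult_ac)
  also have "\<dots> = (\<Sum>i=1..n. f i *
      (\<Sum>M\<in>mset_partitions n. of_nat (count M i) * x ^ (size M - 1) / of_nat (z_mset M)))"
    by (subst sum.swap) (simp add: sum_distrib_left)
  also have "\<dots> = (\<Sum>i=1..n. f i * (part_sum x (n - i) / of_nat i))"
    by (intro sum.cong refl arg_cong2[where f = "(*)"] sum_count_partitions) auto
  finally show ?thesis by simp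
qed

lemma part_sum_0: "part_sum x 0 = 1"
proof -
  have "mset_partitions 0 = {{#}}"
    by (auto simp: mset_partitions_def) (metis multiset_nonemptyE)
  then show ?thesis by (simp add: part_sum_def z_mset_def)
qed

text \<open>The weight \<open>f i = i\<close> totals \<open>n\<close> on each partition of
  \<open>n\<close>, while \<open>f i / i = 1\<close> on the other side of
  \<open>sum_partitions_parts\<close>.\<close>

lemma part_sum_rec: "of_nat n * part_sum x n = x * (\<Sum>i<n. part_sum x i)"
proof (cases "n = 0")
  case False
  have "of_nat n * part_sum x n = (\<Sum>M\<in>mset_partitions n.
      x * (sum_mset (image_mset of_nat M) * x ^ (size M - 1) / of_nat (z_mset M)))"
    unfolding part_sum_def sum_distrib_left
  proof (rule sum.cong)
    fix M assume M: "M \<in> mset_partitions n"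
    then have "sum_mset (image_mset of_nat M) = (of_nat n :: 'a)"
      by (simp add: mset_partitions_def flip: of_nat_sum_mset)
    moreover have "size M \<noteq> 0"
      using M False by (auto simp: mset_partitions_def)
    then have "x ^ size M = x * x ^ (size M - 1)"
      by (simp add: power_eq_if)
    ultimately show "of_nat n * (x ^ size M / of_nat (z_mset M)) =
        x * (sum_mset (image_mset of_nat M) * x ^ (size M - 1) / of_nat (z_mset M))"
      by simp
  qed simp
  also have "\<dots> = x * (\<Sum>i=1..n. part_sum x (n - i))"
    unfolding sum_distrib_left[symmetric] sum_partitions_parts
    by (intro arg_cong2[where f = "(*)"] sum.cong) auto
  also have "(\<Sum>i=1..n. part_sum x (n - i)) = (\<Sum>i<n. part_sum x i)"
    by (rule sum.reindex_bij_witness[where i = "\<lambda>i. n - i" and j = "\<lambda>i. n - i"]) auto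
  finally show ?thesis .
qed simp

text \<open>The difference of two consecutive instances of \<open>part_sum_rec\<close> is a
  first-order recurrence, the one satisfied by \<open>pochhammer x n / fact n\<close>.\<close>

lemma part_sum_eq: "part_sum x n = pochhammer x n / fact n"
proof (induction n)
  case (Suc n)
  have "of_nat (Suc n) * part_sum x (Suc n) = (of_nat n + x) * part_sum x n"
    using part_sum_rec[of "Suc n" x] part_sum_rec[of n x] by (simp add: algebra_simps)
  then have "part_sum x (Suc n) = (x + of_nat n) * part_sum x n / of_nat (Suc n)"
    by (simp add: field_simps del: of_nat_Suc)
  then show ?case
    by (simp add: Suc pochhammer_Suc field_simps del: of_nat_Suc)
qed (simp add: part_sum_0)

section \<open>Products of binomials and of rising factorials\<close>

text \<open>Trinomial revision extracts \<open>r choose t\<close>, and Vandermonde's convolution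
  sums the rest.\<close>

lemma sum_binomial_products:
  "(\<Sum>j\<le>r. (r choose j) * (s choose j) * (j choose t)) = (r choose t) * ((r + s - t) choose r)"
proof (cases "t \<le> r")
  case True
  have "(\<Sum>j\<le>r. (r choose j) * (s choose j) * (j choose t)) =
      (\<Sum>j\<le>r. (r choose t) * ((s choose j) * ((r - t) choose (r - j))))"
  proof (rule sum.cong)
    fix j assume "j \<in> {..r}"
    then have j: "j \<le> r" by simp
    show "(r choose j) * (s choose j) * (j choose t) =
        (r choose t) * ((s choose j) * ((r - t) choose (r - j)))"
    proof (cases "t \<le> j")
      case True
      have "(r choose j) * (j choose t) = (r choose t) * ((r - t) choose (j - t))"
        using True j by (rule choose_mult)
      also have "(r - t) choose (j - t) = (r - t) choose (r - j)"
        using True j binomial_symmetric[of "j - t" "r - t"] by simp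
      finally show ?thesis by (simp add: ac_simps)
    next
      case False
      \<comment> \<open>For \<open>j < t\<close> the difference \<open>j - t\<close> would be
        truncated, but both sides vanish.\<close>
      then have "r - t < r - j"
        using \<open>t \<le> r\<close> by simp
      then show ?thesis using False by (simp add: binomial_eq_0)
    qed
  qed simp
  also have "\<dots> = (r choose t) * ((s + (r - t)) choose r)"
    by (simp add: sum_distrib_left[symmetric] vandermonde)
  finally show ?thesis using True by (simp add: add.commute)
qed (simp add: binomial_eq_0)

text \<open>Riordan's identity. Expand both sides in the binomials \<open>x gchoose (r + s - t)\<close> by
  Vandermonde's convolution.\<close>

lemma gbinomial_mult_gbinomial:
  fixes x :: "'a::field_char_0"
  shows "(x gchoose r) * (x gchoose s) =
    (\<Sum>j\<le>r. of_nat ((r choose j) * (s choose j)) * ((x + of_nat j) gchoose (r + s)))"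
proof -
  let ?c = "\<lambda>t. of_nat ((r choose t) * ((r + s - t) choose r)) * (x gchoose (r + s - t)) :: 'a"
  \<comment> \<open>Splitting \<open>x = r + (x - r)\<close> in the second factor prepares trinomial
    revision against \<open>x gchoose r\<close>.\<close>
  have "(x gchoose r) * (x gchoose s) =
      (\<Sum>t=0..s. (x gchoose r) * ((of_nat r gchoose t) * ((x - of_nat r) gchoose (s - t))))"
    using gbinomial_Vandermonde[of "of_nat r" "x - of_nat r" s]
    by (simp flip: sum_distrib_left)
  also have "\<dots> = (\<Sum>t=0..s. ?c t)"
  proof (rule sum.cong)
    fix t assume "t \<in> {0..s}"
    then have "r \<le> r + s - t" "r + s - t - r = s - t" by auto
    then have "(x gchoose r) * ((x - of_nat r) gchoose (s - t)) =
        (x gchoose (r + s - t)) * of_nat ((r + s - t) choose r)"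
      using gbinomial_trinomial_revision[of r "r + s - t" x] by (simp add: binomial_gbinomial)
    then show "(x gchoose r) * ((of_nat r gchoose t) * ((x - of_nat r) gchoose (s - t))) = ?c t"
      by (simp add: binomial_gbinomial mult_ac)
  qed simp
  also have "\<dots> = (\<Sum>t=0..r+s. ?c t)"
    by (rule sum.mono_neutral_left) (auto simp: binomial_eq_0)
  \<comment> \<open>\<open>sum_binomial_products\<close> is read from right to left; the sum over
    \<open>t\<close> is then a convolution for each \<open>j\<close>.\<close>
  also have "\<dots> = (\<Sum>t=0..r+s. \<Sum>j\<le>r. of_nat ((r choose j) * (s choose j)) *
      ((of_nat j gchoose t) * (x gchoose (r + s - t))))"
    unfolding sum_binomial_products[symmetric] of_nat_sum sum_distrib_right
    by (simp add: binomial_gbinomial mult_ac)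
  also have "\<dots> = (\<Sum>j\<le>r. of_nat ((r choose j) * (s choose j)) *
      (\<Sum>t=0..r+s. (of_nat j gchoose t) * (x gchoose (r + s - t))))"
    by (subst sum.swap) (simp add: sum_distrib_left)
  also have "\<dots> = (\<Sum>j\<le>r. of_nat ((r choose j) * (s choose j)) * ((x + of_nat j) gchoose (r + s)))"
    by (simp add: gbinomial_Vandermonde add.commute)
  finally show ?thesis .
qed

lemma pochhammer_minus_of_nat:
  "pochhammer (- of_nat p) j = ((-1) ^ j * fact j * of_nat (p choose j) :: 'a::field_char_0)"
  by (simp add: binomial_gbinomial gbinomial_pochhammer)

text \<open>Riordan's identity at \<open>x = -i\<close>; negating the upper arguments absorbs the
  signs and leaves ordinary binomials.\<close>

lemma pochhammer_mult_pochhammer: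
  fixes i r s :: nat
  assumes "0 < r" "0 < s"
  shows "pochhammer (of_nat i) r * pochhammer (of_nat i) s =
    (fact r * fact s * of_nat (\<Sum>j\<le>r. (r choose j) * (s choose j) * ((r + s - 1 - j + i) choose (r + s)))
      :: 'a::field_char_0)"
proof -
  have "pochhammer (of_nat i) m = ((-1) ^ m * fact m * (- of_nat i gchoose m) :: 'a)" for m
    by (simp add: gbinomial_pochhammer)
  then have "pochhammer (of_nat i) r * pochhammer (of_nat i) s =
      (fact r * fact s * ((-1) ^ (r + s) * ((- of_nat i gchoose r) * (- of_nat i gchoose s))) :: 'a)"
    by (simp add: power_add)
  also have "(-1) ^ (r + s) * ((- of_nat i gchoose r) * (- of_nat i gchoose s)) =
      (\<Sum>j\<le>r. of_nat ((r choose j) * (s choose j)) *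
        ((-1) ^ (r + s) * ((- of_nat i + of_nat j) gchoose (r + s))) :: 'a)"
    by (simp add: gbinomial_mult_gbinomial sum_distrib_left mult_ac)
  also have "\<dots> = (\<Sum>j\<le>r. of_nat ((r choose j) * (s choose j)) * of_nat ((r + s - 1 - j + i) choose (r + s)))"
  proof (intro sum.cong refl arg_cong2[where f = "(*)"])
    fix j assume "j \<in> {..r}"
    \<comment> \<open>This bound, from \<open>0 < s\<close>, keeps \<open>r + s - 1 - j\<close> free
      of truncation.\<close>
    then have "j + 1 \<le> r + s" using assms by auto
    then have eq: "of_nat (r + s - 1 - j + i) = (of_nat (r + s) - (- of_nat i + of_nat j) - 1 :: 'a)"
      by (simp add: of_nat_diff)
    show "(-1) ^ (r + s) * ((- of_nat i + of_nat j) gchoose (r + s)) =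
        (of_nat ((r + s - 1 - j + i) choose (r + s)) :: 'a)"
      by (subst gbinomial_negated_upper) (simp only: binomial_gbinomial eq, simp)
  qed
  finally show ?thesis by simp
qed

section \<open>The coefficients \<open>gen_binom\<close>\<close>

text \<open>The ratio of rising factorials is \<open>k choose j\<close> over
  \<open>N choose j\<close>. Absorption and trinomial revision then cancel the denominator.\<close>

lemma choose_mult_pochhammer_ratio:
  assumes "k \<le> N" "j \<le> N"
  shows "of_nat (Suc N choose Suc k) * (pochhammer (- of_nat k) j / pochhammer (- of_nat N) j) =
    (of_nat (Suc N) / of_nat (Suc k) * of_nat ((N - j) choose (N - k)) :: 'a::field_char_0)"
proof -
  have N: "N choose j \<noteq> 0"
    using assms by simp
  have "(N choose k) * (k choose j) = (N choose j) * ((N - j) choose (N - k))"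
  proof (cases "j \<le> k")
    case True
    then show ?thesis
      using choose_mult[of j k N] binomial_symmetric[of "k - j" "N - j"] assms by simp
  qed (use assms in \<open>simp add: binomial_eq_0\<close>)
  then have 1: "of_nat (N choose k) * of_nat (k choose j) =
      (of_nat (N choose j) * of_nat ((N - j) choose (N - k)) :: 'a)"
    by (simp flip: of_nat_mult)
  have "of_nat (Suc k) * of_nat (Suc N choose Suc k) = (of_nat (Suc N) * of_nat (N choose k) :: 'a)"
    by (metis Suc_times_binomial_eq mult.commute of_nat_mult)
  then have 2: "of_nat (Suc N choose Suc k) = (of_nat (Suc N) / of_nat (Suc k) * of_nat (N choose k) :: 'a)"
    by (simp add: field_simps del: of_nat_Suc binomial_Suc_Suc)
  have "pochhammer (- of_nat k) j / pochhammer (- of_nat N) j =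
      (of_nat (k choose j) / of_nat (N choose j) :: 'a)"
    by (simp add: pochhammer_minus_of_nat)
  then have "of_nat (Suc N choose Suc k) * (pochhammer (- of_nat k) j / pochhammer (- of_nat N) j) =
      (of_nat (Suc N) / of_nat (Suc k) * (of_nat (N choose k) * of_nat (k choose j) / of_nat (N choose j)) :: 'a)"
    unfolding 2 by simp
  also have "\<dots> = of_nat (Suc N) / of_nat (Suc k) * of_nat ((N - j) choose (N - k))"
    unfolding 1 using N by simp
  finally show ?thesis .
qed

text \<open>The factors with \<open>- s\<close> and \<open>- r\<close> give the two binomials in
  \<open>j\<close>, their signs cancelling; \<open>choose_mult_pochhammer_ratio\<close> handles the
  others, with \<open>k - 1\<close> and \<open>r + s - 1\<close> as its parameters.\<close>

lemma gen_binom_eq: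
  assumes "0 < r" "0 < s" "1 \<le> k" "k \<le> r + s"
  shows "gen_binom (r + s) s k = of_nat (r + s) / of_nat k *
    (\<Sum>j\<le>r. of_nat ((r choose j) * (s choose j) * ((r + s - 1 - j) choose (r + s - k))))"
proof -
  obtain N where N: "r + s = Suc N"
    using assms(1) by (metis Suc_pred add_gr_0)
  obtain l where l: "k = Suc l"
    using assms(3) by (metis Suc_le_D One_nat_def)
  have "gen_binom (r + s) s k = (\<Sum>j=0..min s r. of_nat ((r choose j) * (s choose j)) *
      (of_nat (Suc N choose Suc l) * (pochhammer (- of_nat l) j / pochhammer (- of_nat N) j)))"
    unfolding gen_binom_def sum_distrib_left
  proof (intro sum.cong)
    fix j
    have params: "of_nat s - of_nat (r + s) = (- of_nat r :: rat)" "1 - of_nat k = (- of_nat l :: rat)"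
      by (simp_all add: l)
    have params': "1 - of_nat (r + s) = (- of_nat N :: rat)"
      by (simp add: N del: of_nat_add)
    have prod: "pochhammer (- of_nat s) j * pochhammer (- of_nat r) j / (pochhammer 1 j * fact j) =
        (of_nat ((r choose j) * (s choose j)) :: rat)"
      by (simp add: pochhammer_minus_of_nat flip: pochhammer_fact)
    show "of_nat (r + s choose k) * (pochhammer (1 - of_nat k) j * pochhammer (- of_nat s) j *
         pochhammer (of_nat s - of_nat (r + s)) j /
         (pochhammer (1 - of_nat (r + s)) j * pochhammer 1 j * fact j)) =
        of_nat ((r choose j) * (s choose j)) *
         (of_nat (Suc N choose Suc l) * (pochhammer (- of_nat l) j / pochhammer (- of_nat N) j) :: rat)"
      unfolding params params' unfolding prod[symmetric] N l
      by (simp del: binomial_Suc_Suc add: mult_ac)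
  qed auto
  also have "\<dots> = (\<Sum>j=0..min s r. of_nat ((r choose j) * (s choose j)) *
      (of_nat (Suc N) / of_nat (Suc l) * of_nat ((N - j) choose (N - l))))"
    by (intro sum.cong refl arg_cong2[where f = "(*)"] choose_mult_pochhammer_ratio)
      (use assms N l in auto)
  also have "\<dots> = (\<Sum>j\<le>r. of_nat ((r choose j) * (s choose j)) *
      (of_nat (Suc N) / of_nat (Suc l) * of_nat ((N - j) choose (N - l))))"
    by (rule sum.mono_neutral_left) (auto simp: binomial_eq_0)
  finally show ?thesis
    by (simp add: N l sum_distrib_left mult_ac)
qed

text \<open>Absorption trades the divisor \<open>k\<close> from \<open>gen_binom_eq\<close> for
  \<open>i\<close>. Vandermonde's convolution over \<open>k\<close> then produces the sum in
  \<open>pochhammer_mult_pochhammer\<close>.\<close>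

lemma sum_gen_binom:
  assumes "0 < r" "0 < s" "0 < i"
  shows "fact r * fact s / of_nat (r + s) *
      (\<Sum>k=1..r+s. gen_binom (r + s) s k * of_nat ((i - 1) choose (k - 1)))
    = pochhammer (of_nat i) r * pochhammer (of_nat i) s / of_nat i"
proof -
  let ?N = "r + s"
  let ?c = "\<lambda>j. (r choose j) * (s choose j)"
  have absorb: "of_nat ((i - 1) choose (k - 1)) / of_nat k = (of_nat (i choose k) / of_nat i :: rat)"
    if "1 \<le> k" for k
  proof -
    have "k * (i choose k) = i * ((i - 1) choose (k - 1))"
      using that assms(3) times_binomial_minus1_eq by simp
    then have "of_nat k * of_nat (i choose k) = (of_nat i * of_nat ((i - 1) choose (k - 1)) :: rat)"
      by (simp flip: of_nat_mult)
    then show ?thesis using that assms(3) by (simp add: field_simps)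
  qed
  have "(\<Sum>k=1..?N. gen_binom ?N s k * of_nat ((i - 1) choose (k - 1)))
    = (\<Sum>k=1..?N. of_nat ?N / of_nat i *
        (\<Sum>j\<le>r. of_nat (?c j * ((?N - 1 - j) choose (?N - k)) * (i choose k))))"
  proof (rule sum.cong)
    fix k assume k: "k \<in> {1..?N}"
    let ?S = "(\<Sum>j\<le>r. of_nat (?c j * ((?N - 1 - j) choose (?N - k)))) :: rat"
    have "gen_binom ?N s k * of_nat ((i - 1) choose (k - 1)) =
        of_nat ?N * ?S * (of_nat ((i - 1) choose (k - 1)) / of_nat k)"
      using gen_binom_eq[of r s k] assms k by simp
    also have "\<dots> = of_nat ?N / of_nat i * (?S * of_nat (i choose k))"
      using absorb k by simp
    also have "?S * of_nat (i choose k) =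
        (\<Sum>j\<le>r. of_nat (?c j * ((?N - 1 - j) choose (?N - k)) * (i choose k)))"
      by (simp add: sum_distrib_right)
    finally show "gen_binom ?N s k * of_nat ((i - 1) choose (k - 1)) = of_nat ?N / of_nat i *
        (\<Sum>j\<le>r. of_nat (?c j * ((?N - 1 - j) choose (?N - k)) * (i choose k)))" .
  qed simp
  also have "\<dots> = of_nat ?N / of_nat i *
      of_nat (\<Sum>j\<le>r. ?c j * (\<Sum>k=1..?N. (i choose k) * ((?N - 1 - j) choose (?N - k))))"
    unfolding sum_distrib_left[symmetric]
    by (subst sum.swap) (simp add: sum_distrib_left mult_ac)
  also have "(\<Sum>j\<le>r. ?c j * (\<Sum>k=1..?N. (i choose k) * ((?N - 1 - j) choose (?N - k)))) =
      (\<Sum>j\<le>r. ?c j * ((?N - 1 - j + i) choose ?N))"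
  proof (intro sum.cong refl arg_cong2[where f = "(*)"])
    fix j
    have "(\<Sum>k=1..?N. (i choose k) * ((?N - 1 - j) choose (?N - k))) =
        (\<Sum>k\<le>?N. (i choose k) * ((?N - 1 - j) choose (?N - k)))"
    \<comment> \<open>The added term \<open>k = 0\<close> is zero, its second factor having lower
      index \<open>?N\<close> above the upper one.\<close>
    proof (rule sum.mono_neutral_left)
      have "?N - 1 - j < ?N"
        using assms by simp
      then show "\<forall>k\<in>{..?N} - {1..?N}. (i choose k) * ((?N - 1 - j) choose (?N - k)) = 0"
        by (auto simp: binomial_eq_0)
    qed auto
    then show "(\<Sum>k=1..?N. (i choose k) * ((?N - 1 - j) choose (?N - k))) = (?N - 1 - j + i) choose ?N"
      by (simp add: vandermonde add.commute)
  qed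
  finally have sum: "(\<Sum>k=1..?N. gen_binom ?N s k * of_nat ((i - 1) choose (k - 1))) =
      of_nat ?N / of_nat i * of_nat (\<Sum>j\<le>r. ?c j * ((?N - 1 - j + i) choose ?N))" .
  show ?thesis
    unfolding sum pochhammer_mult_pochhammer[OF assms(1,2)]
    using assms by (simp del: of_nat_add of_nat_sum)
qed

text \<open>Compares coefficients in \<open>(q / (1 - q)) ^ k * (1 - q) powr (-x) = q ^ k * (1 - q) powr (-(x + k))\<close>.\<close>

lemma sum_choose_pochhammer:
  fixes x :: "'a::field_char_0"
  assumes "1 \<le> k" "k \<le> n"
  shows "(\<Sum>i=1..n. of_nat ((i - 1) choose (k - 1)) * (pochhammer x (n - i) / fact (n - i)))
    = pochhammer (x + of_nat k) (n - k) / fact (n - k)"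
proof -
  have "(\<Sum>i=1..n. of_nat ((i - 1) choose (k - 1)) * (pochhammer x (n - i) / fact (n - i)))
    = (\<Sum>i=k..n. of_nat ((i - 1) choose (k - 1)) * (pochhammer x (n - i) / fact (n - i)))"
    by (rule sum.mono_neutral_right) (use assms in \<open>auto simp: binomial_eq_0\<close>)
  also have "\<dots> = (\<Sum>d\<le>n-k. of_nat ((d + k - 1) choose (k - 1)) *
      (pochhammer x (n - k - d) / fact (n - k - d)))"
    by (rule sum.reindex_bij_witness[where i = "\<lambda>d. d + k" and j = "\<lambda>i. i - k"])
      (use assms in \<open>auto simp: diff_diff_eq ac_simps\<close>)
  \<comment> \<open>Writing the first coefficient as \<open>pochhammer k d / d!\<close> yields the
    binomial theorem for rising factorials.\<close>
  also have "\<dots> = (\<Sum>d\<le>n-k. of_nat ((n - k) choose d) * pochhammer (of_nat k) d *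
      pochhammer x (n - k - d) / fact (n - k))"
  proof (rule sum.cong)
    fix d assume "d \<in> {..n - k}"
    then have d: "d \<le> n - k" by simp
    have "(d + k - 1) choose (k - 1) = (d + k - 1) choose d"
      using assms binomial_symmetric[of d "d + k - 1"] by simp
    also have "of_nat \<dots> = (pochhammer (of_nat k) d / fact d :: 'a)"
      using assms by (simp add: binomial_gbinomial gbinomial_pochhammer' of_nat_diff)
    finally have "of_nat ((d + k - 1) choose (k - 1)) = (pochhammer (of_nat k) d / fact d :: 'a)" .
    then show "of_nat ((d + k - 1) choose (k - 1)) * (pochhammer x (n - k - d) / fact (n - k - d)) =
        of_nat ((n - k) choose d) * pochhammer (of_nat k) d * pochhammer x (n - k - d) / fact (n - k)"
      using d by (simp add: binomial_fact)
  qed simp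
  also have "\<dots> = pochhammer (x + of_nat k) (n - k) / fact (n - k)"
    by (simp add: pochhammer_binomial_sum[of "of_nat k" x] add.commute[of x] sum_divide_distrib)
  finally show ?thesis .
qed

section \<open>Evaluation at rational points\<close>

lemma poly_poly_binom: "poly (poly_binom Y j) x = poly Y x gchoose j"
  by (simp add: poly_binom_def gbinomial_prod_rev poly_prod atLeast0LessThan)

theorem theorem4:
  fixes n r s :: nat
  assumes "n > 0" and "r > 0" and "s > 0"
  shows "(\<Sum>mu\<in>partitions n.
            smult (1 / of_nat (z_part mu)
                   * (\<Sum>i<length mu. pochhammer (of_nat (mu ! i)) r * pochhammer (of_nat (mu ! i)) s))
              (X ^ (length mu - 1)))
         = smult (fact r * fact s / of_nat (r + s))
             (\<Sum>k=1..min n (r + s).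
                smult (gen_binom (r + s) s k) (poly_binom (X + of_nat n - 1) (n - k)))"
    (is "?lhs = ?rhs")
\<comment> \<open>Polynomials over the rationals are determined by their values, so the field
  identities above apply at each \<open>x\<close>.\<close>
proof (rule poly_ext)
  fix x :: rat
  let ?f = "\<lambda>i. pochhammer (of_nat i) r * pochhammer (of_nat i) s :: rat"
  let ?K = "fact r * fact s / of_nat (r + s) :: rat"
  let ?g = "\<lambda>k. gen_binom (r + s) s k"
  let ?A = "\<lambda>m. pochhammer x m / fact m"
  have "poly ?lhs x = (\<Sum>mu\<in>partitions n. sum_mset (image_mset ?f (mset mu)) *
      x ^ (size (mset mu) - 1) / of_nat (z_mset (mset mu)))"
    by (auto intro!: sum.cong
        simp: poly_sum z_mset_mset sum_list_sum_nth atLeast0LessThan sum_mset_sum_list simp flip: mset_map)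
  also have "\<dots> = (\<Sum>M\<in>mset_partitions n. sum_mset (image_mset ?f M) *
      x ^ (size M - 1) / of_nat (z_mset M))"
    by (rule sum.reindex_bij_betw[OF bij_betw_mset_partitions])
  also have "\<dots> = (\<Sum>i=1..n. ?f i / of_nat i * ?A (n - i))"
    by (simp only: sum_partitions_parts part_sum_eq)
  also have "\<dots> = (\<Sum>i=1..n. ?K * (\<Sum>k=1..r+s. ?g k * of_nat ((i - 1) choose (k - 1))) * ?A (n - i))"
    by (intro sum.cong refl arg_cong2[where f = "(*)"] sum_gen_binom[symmetric]) (use assms in auto)
  also have "\<dots> = ?K * (\<Sum>i=1..n. \<Sum>k=1..r+s. ?g k * (of_nat ((i - 1) choose (k - 1)) * ?A (n - i)))"
    by (simp only: sum_distrib_left sum_distrib_right mult.assoc)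
  also have "\<dots> = ?K * (\<Sum>k=1..r+s. ?g k * (\<Sum>i=1..n. of_nat ((i - 1) choose (k - 1)) * ?A (n - i)))"
    by (subst sum.swap) (simp only: sum_distrib_left)
  \<comment> \<open>For \<open>k > n\<close> all the binomials \<open>(i - 1) choose (k - 1)\<close>
    vanish, whence the \<open>min\<close>.\<close>
  also have "(\<Sum>k=1..r+s. ?g k * (\<Sum>i=1..n. of_nat ((i - 1) choose (k - 1)) * ?A (n - i))) =
      (\<Sum>k=1..min n (r+s). ?g k * (\<Sum>i=1..n. of_nat ((i - 1) choose (k - 1)) * ?A (n - i)))"
    by (rule sum.mono_neutral_right) (auto intro!: sum.neutral simp: binomial_eq_0)
  \<comment> \<open>The rising product from \<open>x + k\<close> with \<open>n - k\<close> factors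
    is the falling one from \<open>x + n - 1\<close>.\<close>
  also have "\<dots> = (\<Sum>k=1..min n (r+s). ?g k * (x + of_nat n - 1 gchoose (n - k)))"
    by (intro sum.cong refl arg_cong2[where f = "(*)"], subst sum_choose_pochhammer)
      (auto simp: gbinomial_pochhammer' of_nat_diff algebra_simps)
  also have "?K * \<dots> = poly ?rhs x"
    by (simp add: poly_sum poly_poly_binom)
  finally show "poly ?lhs x = poly ?rhs x" .
qed

end
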